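(* Let $A\in\mathbb{R}^{m\times n}$, $b\in\mathbb{R}^m$, $\sigma\ge 0$, $p\in\{1,2\}$, and let $\phi:\mathbb{R}_+\to\mathbb{R}_+$ be continuous and nondecreasing with $\phi(0)=0$. Let $G_\sigma:=\{x\in\mathbb{R}^n:\|Ax-b\|_p\le\sigma\}$ and suppose $G_\sigma\ne\emptyset$. If $$\arg\min\{\phi(\|Ax-b\|_p):x\in\mathbb{R}^n\}=G_\sigma,$$ then there exists $\lambda^*>0$ such that for every $\lambda>\lambda^*$ the problems $\min\{\|x\|_0:\|Ax-b\|_p\le\sigma,\ x\in\mathbb{R}^n\}$ and $\min\{\|x\|_0+\lambda\phi(\|Ax-b\|_p):x\in\mathbb{R}^n\}$ have the same optimal solution set.
   Context: $\mathbb{R}_+=[0,+\infty)$; $\|x\|_0$ is the number of nonzero components of $x$; "optimal solution set" and $\arg\min$ mean the set of all global minimizers. *)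

theory Defs
  imports "HOL-Analysis.Analysis"
begin

definition lp_norm :: "nat \<Rightarrow> real ^ 'm \<Rightarrow> real"
  where "lp_norm p x = root p (\<Sum>i\<in>UNIV. \<bar>x $ i\<bar> ^ p)"

lemma lp_norm_1: "lp_norm 1 x = (\<Sum>i\<in>UNIV. \<bar>x $ i\<bar>)"
  by (simp add: lp_norm_def)

lemma lp_norm_2: "lp_norm 2 x = norm x"
  by (simp add: lp_norm_def norm_vec_def L2_set_def sqrt_def)

definition zero_norm :: "real ^ 'n \<Rightarrow> nat"
  where "zero_norm x = card {i. x $ i \<noteq> 0}"

definition argmin_on :: "('a \<Rightarrow> real) \<Rightarrow> 'a set \<Rightarrow> 'a set"
  where "argmin_on f S = {x. is_arg_min f (\<lambda>y. y \<in> S) x}"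

definition residual_ball :: "nat \<Rightarrow> real ^ 'n ^ 'm \<Rightarrow> real ^ 'm \<Rightarrow> real \<Rightarrow> (real ^ 'n) set"
  where "residual_ball p A b \<sigma> = {x. lp_norm p (A *v x - b) \<le> \<sigma>}"

end

theory Submission
  imports Defs
begin

text \<open>
  Let \<open>K\<close> be the least number of nonzero components on \<open>G\<^sub>\<sigma>\<close>. The vectors with fewer nonzero components lie
  in finitely many coordinate subspaces. On each of them the residual norm attains its infimum,
  because the image of the subspace under \<open>A\<close> is closed, and the minimiser lies outside \<open>G\<^sub>\<sigma>\<close>; so by
  monotonicity of \<open>\<phi>\<close> the penalty exceeds its global minimum there by a uniform gap \<open>\<delta>\<close>. Once
  \<open>\<lambda> > K / \<delta>\<close>, no sparsity gained outside \<open>G\<^sub>\<sigma>\<close> can make up for the penalty.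
\<close>

lemma argmin_on_iff: "x \<in> argmin_on f S \<longleftrightarrow> x \<in> S \<and> (\<forall>y\<in>S. f x \<le> f y)"
  by (auto simp: argmin_on_def is_arg_min_def not_less)

text \<open>Outside \<open>G\<close> the penalised objective stays strictly above its value at
  \<open>x0\<close>. Where \<open>f\<close> drops below \<open>f x0\<close>, the drop is at most
  \<open>f x0\<close> because \<open>f\<close> is nonnegative, and \<open>lam * \<delta>\<close>
  exceeds that; elsewhere \<open>g\<close> alone is strictly larger. On \<open>G\<close> the penalty
  is constant, so both problems rank its points by \<open>f\<close>.\<close>

lemma exact_penalty_argmin:
  fixes f g :: "'a \<Rightarrow> real"
  assumes f_nonneg: "\<And>x. 0 \<le> f x"
    and x0: "x0 \<in> argmin_on f G"
    and G: "argmin_on g UNIV = G"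
    and "\<delta> > 0"
    and gap: "\<And>x. f x < f x0 \<Longrightarrow> g x0 + \<delta> \<le> g x"
    and lam: "lam > f x0 / \<delta>"
  shows "argmin_on f G = argmin_on (\<lambda>x. f x + lam * g x) UNIV"
proof -
  have "0 \<le> f x0 / \<delta>"
    using f_nonneg \<open>\<delta> > 0\<close> by simp
  with lam have "lam > 0" by linarith
  have "x0 \<in> G" and f_min: "\<And>y. y \<in> G \<Longrightarrow> f x0 \<le> f y"
    using x0 by (auto simp: argmin_on_iff)
  then have g_min: "g x0 \<le> g y" for y
    using G by (auto simp: argmin_on_iff)
  have g_G: "g x = g x0" if "x \<in> G" for x
  proof (rule order_antisym)
    show "g x \<le> g x0"
      using that unfolding G[symmetric] argmin_on_iff by blast
  qed (rule g_min)
  have outside: "f x0 + lam * g x0 < f x + lam * g x" if "x \<notin> G" for x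
  proof (cases "f x < f x0")
    case True
    have "f x0 < lam * \<delta>"
      using lam \<open>\<delta> > 0\<close> by (simp add: pos_divide_less_eq)
    moreover have "lam * (g x0 + \<delta>) \<le> lam * g x"
      using gap[OF True] \<open>lam > 0\<close> by simp
    ultimately show ?thesis
      using f_nonneg[of x] by (simp add: distrib_left)
  next
    case False
    \<comment> \<open>A point outside \<open>G\<close> is no global minimiser of \<open>g\<close>,
      so some point beats it strictly; no uniform gap is needed in this case.\<close>
    from that obtain y where "g y < g x"
      unfolding G[symmetric] argmin_on_iff by (auto simp: not_le)
    with g_min[of y] have "g x0 < g x" by linarith
    with \<open>lam > 0\<close> have "lam * g x0 < lam * g x" by simp
    with False show ?thesis by linarith
  qed
  have x0_min: "f x0 + lam * g x0 \<le> f x + lam * g x" for x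
    using outside[of x] f_min[of x] g_G[of x] by (cases "x \<in> G") auto
  show ?thesis
  proof (intro set_eqI iffI)
    fix x assume "x \<in> argmin_on f G"
    then have "x \<in> G" "f x \<le> f x0"
      using \<open>x0 \<in> G\<close> by (auto simp: argmin_on_iff)
    then have "f x + lam * g x \<le> f y + lam * g y" for y
      using x0_min[of y] g_G[of x] by simp
    then show "x \<in> argmin_on (\<lambda>x. f x + lam * g x) UNIV"
      by (simp add: argmin_on_iff)
  next
    fix x assume "x \<in> argmin_on (\<lambda>x. f x + lam * g x) UNIV"
    then have le: "f x + lam * g x \<le> f x0 + lam * g x0"
      by (simp add: argmin_on_iff)
    then have "x \<in> G"
      using outside[of x] by force
    moreover have "f x \<le> f y" if "y \<in> G" for y
      using le g_G[OF \<open>x \<in> G\<close>] f_min[OF that] by simp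
    ultimately show "x \<in> argmin_on f G"
      by (simp add: argmin_on_iff)
  qed
qed

text \<open>Only points with \<open>f y \<le> f w\<close>, for a fixed \<open>w\<close> in
  \<open>T\<close>, compete for the minimum, and coercivity confines them to a compact part of
  \<open>T\<close>.\<close>

lemma closed_coercive_attains_inf:
  fixes f :: "'a::euclidean_space \<Rightarrow> real"
  assumes "closed T" "T \<noteq> {}" "continuous_on UNIV f"
    and coercive: "\<And>y. norm y \<le> f y"
  obtains z where "z \<in> T" "\<And>y. y \<in> T \<Longrightarrow> f z \<le> f y"
proof -
  from \<open>T \<noteq> {}\<close> obtain w where "w \<in> T" by blast
  let ?C = "T \<inter> cball 0 (f w)"
  have "compact ?C"
    using \<open>closed T\<close> by (simp add: closed_Int_compact)
  moreover have "w \<in> ?C"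
    using \<open>w \<in> T\<close> coercive[of w] by simp
  moreover have "continuous_on ?C f"
    using \<open>continuous_on UNIV f\<close> continuous_on_subset by blast
  ultimately obtain z where z: "z \<in> ?C" "\<And>y. y \<in> ?C \<Longrightarrow> f z \<le> f y"
    using continuous_attains_inf[of ?C f] by blast
  have "f z \<le> f y" if "y \<in> T" for y
  proof (cases "f y \<le> f w")
    case True
    then have "y \<in> ?C"
      using that coercive[of y] by simp
    then show ?thesis by (rule z(2))
  next
    case False
    then show ?thesis
      using z(2)[OF \<open>w \<in> ?C\<close>] by linarith
  qed
  with z(1) that show ?thesis by blast
qed

lemma continuous_on_lp_norm:
  assumes "p > 0"
  shows "continuous_on S (lp_norm p)"
  unfolding lp_norm_def by (intro continuous_intros)

lemma lp_norm_nonneg: "0 \<le> lp_norm p x"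
  unfolding lp_norm_def by (cases "p = 0") (auto intro!: sum_nonneg real_root_ge_zero)

text \<open>Supplies the coercivity required by \<open>closed_coercive_attains_inf\<close>.\<close>

lemma norm_le_lp_norm:
  assumes "p \<in> {1, 2}"
  shows "norm x \<le> lp_norm p x"
proof (cases "p = 1")
  case True
  then show ?thesis
    using norm_le_l1_cart[of x] lp_norm_1[of x] by simp
next
  case False
  then have "p = 2" using assms by simp
  then show ?thesis by (simp add: lp_norm_2)
qed

text \<open>The minimisation runs over the residuals rather than over \<open>V\<close>: if
  \<open>A\<close> has a kernel in \<open>V\<close>, the residual norm is not coercive in
  \<open>x\<close>, but it is always coercive in the residual itself.\<close>

lemma lp_residual_attains_inf_on_subspace:
  fixes A :: "real ^ 'n ^ 'm"
  assumes "p \<in> {1, 2}" "subspace V"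
  obtains z where "z \<in> V" "\<And>x. x \<in> V \<Longrightarrow> lp_norm p (A *v z - b) \<le> lp_norm p (A *v x - b)"
proof -
  let ?T = "(\<lambda>y. y - b) ` ((*v) A ` V)"
  have "closed ?T"
    using assms(2) by (intro closed_translation_subtract closed_subspace linear_subspace_image matrix_vector_mul_linear)
  moreover have "?T \<noteq> {}"
    using subspace_0[OF assms(2)] by blast
  moreover have "continuous_on UNIV (lp_norm p :: real ^ 'm \<Rightarrow> real)"
    using assms(1) by (intro continuous_on_lp_norm) auto
  ultimately obtain y where "y \<in> ?T" "\<And>w. w \<in> ?T \<Longrightarrow> lp_norm p y \<le> lp_norm p w"
    using closed_coercive_attains_inf[of ?T "lp_norm p"] norm_le_lp_norm[OF assms(1)] by blast
  with that show ?thesis by blast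
qed

lemma subspace_supported_on: "subspace {x :: real ^ 'n. {i. x $ i \<noteq> 0} \<subseteq> S}"
  by (force simp: subspace_def)

theorem theorem5p1:
  fixes A :: "real ^ 'n ^ 'm" and b :: "real ^ 'm"
    and \<sigma> :: real and p :: nat and \<phi> :: "real \<Rightarrow> real"
  assumes "\<sigma> \<ge> 0" and "p \<in> {1, 2}"
    and "\<phi> \<in> {0..} \<rightarrow> {0..}"
    and "continuous_on {0..} \<phi>" and "mono_on {0..} \<phi>" and "\<phi> 0 = 0"
    and "residual_ball p A b \<sigma> \<noteq> {}"
    and "argmin_on (\<lambda>x. \<phi> (lp_norm p (A *v x - b))) UNIV = residual_ball p A b \<sigma>"
  shows "\<exists>lam_star>0. \<forall>lam>lam_star.
    argmin_on (\<lambda>x. real (zero_norm x)) (residual_ball p A b \<sigma>)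
    = argmin_on (\<lambda>x. real (zero_norm x) + lam * \<phi> (lp_norm p (A *v x - b))) UNIV"
proof -
  define g where "g x = \<phi> (lp_norm p (A *v x - b))" for x
  let ?G = "residual_ball p A b \<sigma>"
  have G: "argmin_on g UNIV = ?G"
    using assms(8) by (simp add: g_def[abs_def])
  from assms(7) obtain x0 where "x0 \<in> ?G" and x0_min: "\<And>y. y \<in> ?G \<Longrightarrow> zero_norm x0 \<le> zero_norm y"
    using ex_has_least_nat[of "\<lambda>x. x \<in> ?G" _ zero_norm] by blast
  then have x0: "x0 \<in> argmin_on (\<lambda>x. real (zero_norm x)) ?G"
    by (simp add: argmin_on_iff)
  have "\<exists>d>0. card S < zero_norm x0 \<longrightarrow> (\<forall>x. {i. x $ i \<noteq> 0} \<subseteq> S \<longrightarrow> g x0 + d \<le> g x)"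
    for S :: "'n set"
  proof (cases "card S < zero_norm x0")
    case True
    obtain z where z: "{i. z $ i \<noteq> 0} \<subseteq> S"
      and z_min: "\<And>x. {i. x $ i \<noteq> 0} \<subseteq> S \<Longrightarrow> lp_norm p (A *v z - b) \<le> lp_norm p (A *v x - b)"
      by (rule lp_residual_attains_inf_on_subspace
          [OF assms(2) subspace_supported_on[of S], of A b, unfolded mem_Collect_eq]) (rule that)
    \<comment> \<open>Being sparser than the sparsest point of \<open>?G\<close>, \<open>z\<close>
      lies outside it and so fails to minimise \<open>g\<close>; this makes the gap at
      \<open>z\<close> strict.\<close>
    have "zero_norm z < zero_norm x0"
      using card_mono[OF _ z] True by (simp add: zero_norm_def)
    then have "z \<notin> ?G"
      using x0_min[of z] by force
    then obtain y where "g y < g z"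
      unfolding G[symmetric] argmin_on_iff by (auto simp: not_le)
    moreover have "g x0 \<le> g y"
      using \<open>x0 \<in> ?G\<close> unfolding G[symmetric] argmin_on_iff by blast
    ultimately have "g z - g x0 > 0" by linarith
    moreover have "g z \<le> g x" if "{i. x $ i \<noteq> 0} \<subseteq> S" for x
      unfolding g_def using assms(5) z_min[OF that] by (auto intro: mono_onD simp: lp_norm_nonneg)
    ultimately show ?thesis
      by (intro exI[of _ "g z - g x0"]) simp
  next
    case False
    \<comment> \<open>The value 1 is arbitrary: it only keeps \<open>d\<close> positive on every
      \<open>S\<close>, so that one minimum over all supports can be taken.\<close>
    then show ?thesis by (intro exI[of _ 1]) simp
  qed
  then obtain d where d: "\<And>S :: 'n set. d S > 0"
    and d_gap: "\<And>S x. card S < zero_norm x0 \<Longrightarrow> {i. x $ i \<noteq> 0} \<subseteq> S \<Longrightarrow> g x0 + d S \<le> g x"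
    by metis
  define \<delta> where "\<delta> = Min (range d)"
  \<comment> \<open>The index type is finite, so there are finitely many sets \<open>S\<close> and
    the minimum is one of the positive values of \<open>d\<close>.\<close>
  have "\<delta> > 0"
    using d by (simp add: \<delta>_def)
  have gap: "g x0 + \<delta> \<le> g x" if "real (zero_norm x) < real (zero_norm x0)" for x
  proof -
    have "\<delta> \<le> d {i. x $ i \<noteq> 0}"
      by (simp add: \<delta>_def)
    moreover have "g x0 + d {i. x $ i \<noteq> 0} \<le> g x"
      using that by (intro d_gap) (simp_all add: zero_norm_def)
    ultimately show ?thesis by linarith
  qed
  \<comment> \<open>The added 1 keeps the threshold positive even when \<open>x0\<close> is the zero
    vector.\<close>
  have "argmin_on (\<lambda>x. real (zero_norm x)) ?G = argmin_on (\<lambda>x. real (zero_norm x) + lam * g x) UNIV"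
    if "lam > real (zero_norm x0) / \<delta> + 1" for lam
    using that by (intro exact_penalty_argmin[OF _ x0 G \<open>\<delta> > 0\<close> gap]) auto
  moreover have "real (zero_norm x0) / \<delta> + 1 > 0"
    using \<open>\<delta> > 0\<close> by (intro add_nonneg_pos) simp_all
  ultimately show ?thesis
    unfolding g_def by blast
qed

end
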